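(* Let $p$ be a prime integer, let $A$ be a ring, $E$ an $A$-module and let $A\propto E$ be the trivial ring extension of $A$ by $E$. Then: (1) $A\propto E$ is a von Neumann regular ring if and only if $A$ is a von Neumann regular ring and $E=\{0\}$. (2) $A\propto E$ is a $p$-ring if and only if $A$ is a $p$-ring and $E=\{0\}$.
   Context: All rings are commutative with identity element $\neq 0$ and all modules are unital. For a prime integer $p$, a ring $R$ is called a $p$-ring if $x^p=x$ and $px=0$ for each $x\in R$. A ring $R$ is von Neumann regular if for each $a\in R$ there is some $b\in R$ such that $a=a^2b$. The trivial ring extension $A\propto E$ of a ring $A$ by an $A$-module $E$ is the set of pairs $(a,e)$ with $a\in A$, $e\in E$, with componentwise addition and multiplication $(a,e)(b,f)=(ab,af+be)$. *)

theory Defs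
  imports "HOL-Algebra.Algebra"
begin

(* Rings here are commutative with one distinct from zero. *)

locale nonzero_cring = cring +
  assumes one_neq_zero: "\<one> \<noteq> \<zero>"

locale von_neumann_regular_ring = nonzero_cring +
  assumes regular: "a \<in> carrier R \<Longrightarrow> \<exists>b\<in>carrier R. a = a [^] (2::nat) \<otimes> b"

locale p_ring = nonzero_cring R for p :: nat and R (structure) +
  assumes prime_p: "Factorial_Ring.prime p"
    and pow_p: "x \<in> carrier R \<Longrightarrow> x [^] p = x"
    and p_mult: "x \<in> carrier R \<Longrightarrow> add_pow R p x = \<zero>"

definition trivial_extension ::
    "('a, 'c) ring_scheme \<Rightarrow> ('a, 'b, 'd) module_scheme \<Rightarrow> ('a \<times> 'b) ring"
    (infixl "\<propto>" 70)
  where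
  "A \<propto> E =
    \<lparr> carrier = carrier A \<times> carrier E,
      monoid.mult = (\<lambda>(a, e) (b, f). (a \<otimes>\<^bsub>A\<^esub> b, (a \<odot>\<^bsub>E\<^esub> f) \<oplus>\<^bsub>E\<^esub> (b \<odot>\<^bsub>E\<^esub> e))),
      one = (\<one>\<^bsub>A\<^esub>, \<zero>\<^bsub>E\<^esub>),
      ring.zero = (\<zero>\<^bsub>A\<^esub>, \<zero>\<^bsub>E\<^esub>),
      add = (\<lambda>(a, e) (b, f). (a \<oplus>\<^bsub>A\<^esub> b, e \<oplus>\<^bsub>E\<^esub> f)) \<rparr>"

end

theory Submission
  imports Defs
begin

text \<open>
  Every element \<open>(0, e)\<close> of \<open>A \<propto> E\<close> has square zero, while a von Neumann regular ring is
  reduced: \<open>a = a\<^sup>2 b\<close> forces \<open>a = 0\<close> as soon as \<open>a\<^sup>2 = 0\<close>.  So \<open>E\<close> must vanish if \<open>A \<propto> E\<close> is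
  regular (\<open>regular_trivial_extension_imp_trivial_module\<close>).  This covers \<open>p\<close>-rings as well, because
  \<open>x = x\<^sup>p = x\<^sup>2 x\<^sup>p\<^sup>-\<^sup>2\<close> makes every \<open>p\<close>-ring regular
  (\<open>p_ring.is_von_neumann_regular_ring\<close>).

  Both ring properties are given by identities, with an existential witness in the regular case, so
  they pass to nonzero homomorphic images (\<open>von_neumann_regular_ring.surjective_image\<close>,
  \<open>p_ring.surjective_image\<close>).  The projection \<open>A \<propto> E \<rightarrow> A\<close> is always surjective, and
  the inclusion \<open>a \<mapsto> (a, 0)\<close> of \<open>A\<close> is surjective when \<open>E = 0\<close>; these two maps carry
  the properties from \<open>A \<propto> E\<close> to \<open>A\<close> and back.
\<close>

lemma trivial_extension_sel [simp]:
  "carrier (A \<propto> E) = carrier A \<times> carrier E"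
  "(a, e) \<otimes>\<^bsub>A \<propto> E\<^esub> (b, f) = (a \<otimes>\<^bsub>A\<^esub> b, (a \<odot>\<^bsub>E\<^esub> f) \<oplus>\<^bsub>E\<^esub> (b \<odot>\<^bsub>E\<^esub> e))"
  "\<one>\<^bsub>A \<propto> E\<^esub> = (\<one>\<^bsub>A\<^esub>, \<zero>\<^bsub>E\<^esub>)"
  "\<zero>\<^bsub>A \<propto> E\<^esub> = (\<zero>\<^bsub>A\<^esub>, \<zero>\<^bsub>E\<^esub>)"
  "(a, e) \<oplus>\<^bsub>A \<propto> E\<^esub> (b, f) = (a \<oplus>\<^bsub>A\<^esub> b, e \<oplus>\<^bsub>E\<^esub> f)"
  by (simp_all add: trivial_extension_def)

lemma (in module) trivial_extension_cring: "cring (R \<propto> M)"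
proof (rule cringI)
  show "abelian_group (R \<propto> M)"
  proof (rule abelian_groupI)
    fix x assume "x \<in> carrier (R \<propto> M)"
    then obtain a e where "x = (a, e)" "a \<in> carrier R" "e \<in> carrier M" by auto
    then show "\<exists>y\<in>carrier (R \<propto> M). y \<oplus>\<^bsub>R \<propto> M\<^esub> x = \<zero>\<^bsub>R \<propto> M\<^esub>"
      by (intro bexI[of _ "(\<ominus> a, \<ominus>\<^bsub>M\<^esub> e)"]) (simp_all add: R.l_neg M.l_neg)
  qed (auto simp: R.add.m_ac M.add.m_ac)
  show "comm_monoid (R \<propto> M)"
  proof (rule comm_monoidI)
    fix x y z
    assume "x \<in> carrier (R \<propto> M)" "y \<in> carrier (R \<propto> M)" "z \<in> carrier (R \<propto> M)"
    then obtain a e b f c g where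
      "x = (a, e)" "y = (b, f)" "z = (c, g)"
      and closed: "a \<in> carrier R" "b \<in> carrier R" "c \<in> carrier R"
        "e \<in> carrier M" "f \<in> carrier M" "g \<in> carrier M"
      by auto
    \<comment> \<open>Scalars act only from the left, so the second components of the two products list them
      in different orders; commutativity of the base ring reconciles these.\<close>
    moreover have "c \<odot>\<^bsub>M\<^esub> (a \<odot>\<^bsub>M\<^esub> f) = a \<odot>\<^bsub>M\<^esub> (c \<odot>\<^bsub>M\<^esub> f)"
      and "c \<odot>\<^bsub>M\<^esub> (b \<odot>\<^bsub>M\<^esub> e) = b \<odot>\<^bsub>M\<^esub> (c \<odot>\<^bsub>M\<^esub> e)"
      using closed by (simp_all add: smult_assoc1[symmetric] R.m_comm)
    ultimately show "x \<otimes>\<^bsub>R \<propto> M\<^esub> y \<otimes>\<^bsub>R \<propto> M\<^esub> z = x \<otimes>\<^bsub>R \<propto> M\<^esub> (y \<otimes>\<^bsub>R \<propto> M\<^esub> z)"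
      by (simp add: R.m_assoc smult_assoc1 smult_r_distr M.a_assoc)
  qed (auto simp: R.m_comm M.a_comm)
  fix x y z
  assume "x \<in> carrier (R \<propto> M)" "y \<in> carrier (R \<propto> M)" "z \<in> carrier (R \<propto> M)"
  then show "(x \<oplus>\<^bsub>R \<propto> M\<^esub> y) \<otimes>\<^bsub>R \<propto> M\<^esub> z = x \<otimes>\<^bsub>R \<propto> M\<^esub> z \<oplus>\<^bsub>R \<propto> M\<^esub> y \<otimes>\<^bsub>R \<propto> M\<^esub> z"
    by (auto simp: R.l_distr smult_l_distr smult_r_distr M.add.m_ac)
qed

lemma (in module) trivial_extension_nonzero_cring:
  assumes "nonzero_cring R"
  shows "nonzero_cring (R \<propto> M)"
proof -
  interpret T: cring "R \<propto> M" by (rule trivial_extension_cring)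
  show ?thesis
    using nonzero_cring.one_neq_zero[OF assms] by unfold_locales simp
qed

lemma (in module) fst_trivial_extension_hom: "fst \<in> ring_hom (R \<propto> M) R"
  by (rule ring_hom_memI) auto

lemma (in module) fst_trivial_extension_surj: "fst ` carrier (R \<propto> M) = carrier R"
  using M.zero_closed by force

lemma (in module) inclusion_trivial_extension_hom:
  "(\<lambda>a. (a, \<zero>\<^bsub>M\<^esub>)) \<in> ring_hom R (R \<propto> M)"
  by (rule ring_hom_memI) auto

lemma (in von_neumann_regular_ring) square_zero_imp_zero:
  assumes "a \<in> carrier R" "a \<otimes> a = \<zero>"
  shows "a = \<zero>"
proof -
  obtain b where "b \<in> carrier R" "a = a [^] (2::nat) \<otimes> b"
    using regular assms(1) by blast
  then show ?thesis
    using assms by (simp add: numeral_2_eq_2)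
qed

text \<open>Since \<open>p \<ge> 2\<close>, two factors split off from \<open>a = a\<^sup>p\<close>, and the remaining power of \<open>a\<close>
  is a quasi-inverse of \<open>a\<close>.\<close>

lemma (in p_ring) is_von_neumann_regular_ring: "von_neumann_regular_ring R"
proof
  fix a assume a: "a \<in> carrier R"
  have "2 + (p - 2) = p"
    using prime_ge_2_nat[OF prime_p] by simp
  then have "a [^] (2::nat) \<otimes> a [^] (p - 2) = a"
    using a by (simp add: nat_pow_mult pow_p)
  then show "\<exists>b\<in>carrier R. a = a [^] (2::nat) \<otimes> b"
    using a by (intro bexI[of _ "a [^] (p - 2)"]) simp_all
qed

lemma (in ring_hom_ring) hom_add_pow_nat:
  assumes "x \<in> carrier R"
  shows "h (add_pow R (n::nat) x) = add_pow S n (h x)"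
  using group_hom.hom_nat_pow[OF a_group_hom, of x n] assms by (simp add: add_pow_def)

text \<open>Apply \<open>h\<close> to a quasi-inverse of a preimage.  The image has to be assumed nonzero, since
  the zero ring is also a homomorphic image.\<close>

lemma (in von_neumann_regular_ring) surjective_image:
  assumes "nonzero_cring S" "h \<in> ring_hom R S" "h ` carrier R = carrier S"
  shows "von_neumann_regular_ring S"
proof -
  interpret S: nonzero_cring S by fact
  interpret h: ring_hom_cring R S h by unfold_locales fact
  show ?thesis
  proof
    fix y assume "y \<in> carrier S"
    then obtain x where x: "x \<in> carrier R" "y = h x"
      using assms(3) by auto
    then obtain b where b: "b \<in> carrier R" "x = x [^] (2::nat) \<otimes> b"
      using regular by blast
    then have "h x = h (x [^] (2::nat) \<otimes> b)" by simp
    also have "\<dots> = h x [^]\<^bsub>S\<^esub> (2::nat) \<otimes>\<^bsub>S\<^esub> h b"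
      using x b(1) by (simp add: h.ring.hom_nat_pow)
    finally show "\<exists>b\<in>carrier S. y = y [^]\<^bsub>S\<^esub> (2::nat) \<otimes>\<^bsub>S\<^esub> b"
      using x b(1) by blast
  qed
qed

lemma (in p_ring) surjective_image:
  assumes "nonzero_cring S" "h \<in> ring_hom R S" "h ` carrier R = carrier S"
  shows "p_ring p S"
proof -
  interpret S: nonzero_cring S by fact
  interpret h: ring_hom_cring R S h by unfold_locales fact
  show ?thesis
  proof
    fix y assume "y \<in> carrier S"
    then obtain x where x: "x \<in> carrier R" "y = h x"
      using assms(3) by auto
    show "y [^]\<^bsub>S\<^esub> p = y"
      using x by (simp add: h.ring.hom_nat_pow[symmetric] pow_p)
    show "add_pow S p y = \<zero>\<^bsub>S\<^esub>"
      using x by (simp add: h.ring.hom_add_pow_nat[symmetric] p_mult)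
  qed (rule prime_p)
qed

text \<open>The ideal \<open>0 \<propto> M\<close> consists of elements of square zero, so reducedness kills it.\<close>

lemma (in module) regular_trivial_extension_imp_trivial_module:
  assumes "von_neumann_regular_ring (R \<propto> M)"
  shows "carrier M = {\<zero>\<^bsub>M\<^esub>}"
proof -
  interpret T: von_neumann_regular_ring "R \<propto> M" by fact
  have "e = \<zero>\<^bsub>M\<^esub>" if "e \<in> carrier M" for e
    using T.square_zero_imp_zero[of "(\<zero>, e)"] that by simp
  then show ?thesis by auto
qed

theorem theorem2p13:
  fixes p :: nat
    and A :: "('a, 'c) ring_scheme"
    and E :: "('a, 'b, 'd) module_scheme"
  assumes "Factorial_Ring.prime p"
    and "nonzero_cring A"
    and "module A E"
  shows "(von_neumann_regular_ring (A \<propto> E) \<longleftrightarrow>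
            von_neumann_regular_ring A \<and> carrier E = {\<zero>\<^bsub>E\<^esub>}) \<and>
         (p_ring p (A \<propto> E) \<longleftrightarrow>
            p_ring p A \<and> carrier E = {\<zero>\<^bsub>E\<^esub>})"
proof -
  interpret module A E by fact
  note T = trivial_extension_nonzero_cring[OF assms(2)]
  note proj = assms(2) fst_trivial_extension_hom fst_trivial_extension_surj
  have incl_surj: "(\<lambda>a. (a, \<zero>\<^bsub>E\<^esub>)) ` carrier A = carrier (A \<propto> E)" if "carrier E = {\<zero>\<^bsub>E\<^esub>}"
    using that by auto
  note incl = T inclusion_trivial_extension_hom incl_surj
  show ?thesis
  proof (intro conjI iffI; (elim conjE)?)
    assume reg: "von_neumann_regular_ring (A \<propto> E)"
    show "von_neumann_regular_ring A"
      by (rule von_neumann_regular_ring.surjective_image[OF reg proj])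
    show "carrier E = {\<zero>\<^bsub>E\<^esub>}"
      by (rule regular_trivial_extension_imp_trivial_module[OF reg])
  next
    assume "von_neumann_regular_ring A" "carrier E = {\<zero>\<^bsub>E\<^esub>}"
    then show "von_neumann_regular_ring (A \<propto> E)"
      by (rule von_neumann_regular_ring.surjective_image[OF _ incl])
  next
    assume pr: "p_ring p (A \<propto> E)"
    show "p_ring p A"
      by (rule p_ring.surjective_image[OF pr proj])
    show "carrier E = {\<zero>\<^bsub>E\<^esub>}"
      by (rule regular_trivial_extension_imp_trivial_module
          [OF p_ring.is_von_neumann_regular_ring[OF pr]])
  next
    assume "p_ring p A" "carrier E = {\<zero>\<^bsub>E\<^esub>}"
    then show "p_ring p (A \<propto> E)"
      by (rule p_ring.surjective_image[OF _ incl])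
  qed
qed

end
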